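(* Let $1\le k\le d$ be integers, let $M\subset\mathbb R^d$ be a smooth submanifold of dimension $k$, let $\Psi:U\to M$ be a local parameterization of $M$ (with $U\subset\mathbb R^k$ open), and let $V\subset U$ be compact. Then there exists $\kappa>0$ such that for all $\mathbf s\in U$ and $0<\rho\le1$, the set $$S_{\mathbf s,\rho}:=\big\{\mathbf p/q\in\mathbb Q^d\cap\Psi\big(V\cap B(\mathbf s,\rho)\big):\ q\le\kappa\,\rho^{-1/c(k,d)}\big\}$$ is contained in an affine hyperplane of $\mathbb R^d$.
   Context: $\mathbb N=\{1,2,\dots\}$. Rational points $\mathbf p/q$ are written in reduced form ($\mathbf p\in\mathbb Z^d$, $q\in\mathbb N$, no common factor of $q$ and all the coordinates of $\mathbf p$). $B(\mathbf s,\rho)\subset\mathbb R^k$ is the closed ball in the max norm. A local parameterization of $M$ is a diffeomorphism from an open subset of $\mathbb R^k$ onto an open subset of $M$. The constant $c(k,d)$: let $[n,m]:=\binom{n+m}{m}$. Let $n_{k,d}\in\mathbb N$ be maximal such that $d=[k-1,1]+[k-1,2]+\dots+[k-1,n_{k,d}]+m_{k,d}$ for some $m_{k,d}\ge 0$, and let $m_{k,d}$ be the unique integer satisfying this. Put $N_{k,d}:=1[k-1,1]+2[k-1,2]+\dots+n_{k,d}[k-1,n_{k,d}]+(n_{k,d}+1)m_{k,d}$ and $c(k,d):=(d+1)/N_{k,d}$. *)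

theory Defs
  imports "HOL-Analysis.Analysis"
begin

text \<open>
  For open \<open>W\<close> this is the class \<open>C\<^sup>n\<close>: all iterated directional derivatives up to
  order \<open>n\<close> exist and are continuous. Applying the Frechet derivative to a fixed vector \<open>v\<close>
  keeps the type of the function unchanged along the recursion.
\<close>

primrec higher_differentiable_on ::
    "nat \<Rightarrow> 'a::euclidean_space set \<Rightarrow> ('a \<Rightarrow> 'b::euclidean_space) \<Rightarrow> bool" where
  "higher_differentiable_on 0 W f \<longleftrightarrow> continuous_on W f"
| "higher_differentiable_on (Suc n) W f \<longleftrightarrow>
     (\<forall>x\<in>W. f differentiable (at x)) \<and>
     (\<forall>v. higher_differentiable_on n W (\<lambda>x. frechet_derivative f (at x) v))"

definition smooth_on_open ::
    "'a::euclidean_space set \<Rightarrow> ('a \<Rightarrow> 'b::euclidean_space) \<Rightarrow> bool" where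
  "smooth_on_open W f \<longleftrightarrow> open W \<and> (\<forall>n. higher_differentiable_on n W f)"

text \<open>
  Smoothness on an arbitrary subset of Euclidean space (such as an open subset of a
  submanifold): locally \<open>f\<close> is the restriction of a smooth map on an open set.
\<close>

definition smooth_map_on ::
    "'a::euclidean_space set \<Rightarrow> ('a \<Rightarrow> 'b::euclidean_space) \<Rightarrow> bool" where
  "smooth_map_on X f \<longleftrightarrow>
     (\<forall>x\<in>X. \<exists>W g. x \<in> W \<and> smooth_on_open W g \<and> (\<forall>y\<in>X \<inter> W. g y = f y))"

definition diffeomorphism_onto ::
    "'a::euclidean_space set \<Rightarrow> 'b::euclidean_space set \<Rightarrow> ('a \<Rightarrow> 'b) \<Rightarrow> bool" where
  "diffeomorphism_onto X Y f \<longleftrightarrow>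
     bij_betw f X Y \<and> smooth_map_on X f \<and> smooth_map_on Y (inv_into X f)"

text \<open>
  Embedded \<open>C\<^sup>\<infinity>\<close> submanifolds without boundary, by slice charts: near each of its points \<open>M\<close> is
  straightened to a coordinate subspace of dimension \<open>k\<close> by a diffeomorphism between open
  subsets of the ambient space.
\<close>

definition smooth_submanifold :: "nat \<Rightarrow> (real^'d) set \<Rightarrow> bool" where
  "smooth_submanifold k M \<longleftrightarrow>
     (\<forall>x\<in>M. \<exists>W W' (\<phi> :: real^'d \<Rightarrow> real^'d) J. open W \<and> x \<in> W \<and> open W' \<and> diffeomorphism_onto W W' \<phi> \<and>
        card J = k \<and> \<phi> ` (W \<inter> M) = W' \<inter> {y. \<forall>j. j \<notin> J \<longrightarrow> y $ j = 0})"

definition local_parameterization ::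
    "(real^'d) set \<Rightarrow> (real^'k) set \<Rightarrow> (real^'k \<Rightarrow> real^'d) \<Rightarrow> bool" where
  "local_parameterization M U \<Psi> \<longleftrightarrow>
     open U \<and> openin (top_of_set M) (\<Psi> ` U) \<and> diffeomorphism_onto U (\<Psi> ` U) \<Psi>"

definition max_norm_cball :: "real^'k \<Rightarrow> real \<Rightarrow> (real^'k) set" where
  "max_norm_cball s \<rho> = {x. infnorm (x - s) \<le> \<rho>}"

definition rational_point :: "int^'d \<Rightarrow> nat \<Rightarrow> real^'d" where
  "rational_point p q = (\<chi> i. real_of_int (p $ i) / real q)"

definition reduced :: "int^'d \<Rightarrow> nat \<Rightarrow> bool" where
  "reduced p q \<longleftrightarrow> q \<ge> 1 \<and> Gcd (insert (int q) (range (\<lambda>i. p $ i))) = 1"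

definition bracket :: "nat \<Rightarrow> nat \<Rightarrow> nat" where
  "bracket n m = (n + m) choose m"

text \<open>
  The maximum exists for \<open>1 \<le> k \<le> d\<close>: the summand with \<open>i = 1\<close> is \<open>k\<close>, and all summands are positive.
\<close>

definition n_const :: "nat \<Rightarrow> nat \<Rightarrow> nat" where
  "n_const k d = (GREATEST n. n \<ge> 1 \<and> (\<exists>m. d = (\<Sum>i=1..n. bracket (k - 1) i) + m))"

definition m_const :: "nat \<Rightarrow> nat \<Rightarrow> nat" where
  "m_const k d = (THE m. d = (\<Sum>i=1..n_const k d. bracket (k - 1) i) + m)"

definition N_const :: "nat \<Rightarrow> nat \<Rightarrow> nat" where
  "N_const k d =
     (\<Sum>i=1..n_const k d. i * bracket (k - 1) i) + (n_const k d + 1) * m_const k d"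

definition c_const :: "nat \<Rightarrow> nat \<Rightarrow> real" where
  "c_const k d = (real d + 1) / real (N_const k d)"

definition small_rational_points ::
    "(real^'k \<Rightarrow> real^'d) \<Rightarrow> (real^'k) set \<Rightarrow> real \<Rightarrow> real^'k \<Rightarrow> real \<Rightarrow> (real^'d) set" where
  "small_rational_points \<Psi> V \<kappa> s \<rho> =
     {rational_point p q | p q.
        reduced p q \<and> rational_point p q \<in> \<Psi> ` (V \<inter> max_norm_cball s \<rho>) \<and>
        real q \<le> \<kappa> * \<rho> powr (- 1 / c_const CARD('k) CARD('d))}"

definition affine_hyperplane :: "(real^'d) set \<Rightarrow> bool" where
  "affine_hyperplane H \<longleftrightarrow> (\<exists>a b. a \<noteq> 0 \<and> H = {x. a \<bullet> x = b})"

end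

theory Submission
  imports Defs
begin

text \<open>
  This is a simplex argument. Take \<open>d + 1\<close> points of the set in question, written
  \<open>p\<^sub>i / q\<^sub>i = \<Psi> (z\<^sub>i)\<close> with the \<open>z\<^sub>i\<close> in a ball of radius \<open>\<rho>\<close>, and let \<open>\<Delta>\<close> be the determinant of
  their homogeneous coordinates \<open>(1, p\<^sub>i / q\<^sub>i)\<close>. The product of \<open>\<Delta>\<close> with all the \<open>q\<^sub>i\<close> is an integer
  (\<open>rational_det_lower_bound\<close>), so if \<open>\<Delta> \<noteq> 0\<close>, then \<open>\<bar>\<Delta>\<bar>\<close> is at least the reciprocal of the product of
  the \<open>q\<^sub>i\<close>, hence at least \<open>\<rho>\<^sup>N / \<kappa>\<^bsup>d + 1\<^esup>\<close>, where \<open>N = N_const k d\<close>.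

  On the other hand, \<open>\<bar>\<Delta>\<bar>\<close> is at most a constant times \<open>\<rho>\<^sup>N\<close> (\<open>local_det_bound\<close>,
  \<open>uniform_det_bound\<close>). To see this, replace \<open>\<Psi>\<close> by its Taylor polynomial of degree \<open>n = n_const k d\<close>
  around one of the points, with remainder of order \<open>\<rho>\<^bsup>n + 1\<^esup>\<close> (\<open>uniform_taylor_expansion\<close>), and
  expand the determinant by multilinearity in the rows. A summand that takes the same monomial from
  two rows vanishes, because the two rows are then proportional. So each monomial occurs at most once, and since there are
  \<open>bracket (k - 1) j\<close> monomials of degree \<open>j\<close>, the cheapest remaining summand uses all monomials of
  degree at most \<open>n\<close> and takes the remainder in the other \<open>m_const k d\<close> rows. Its order is exactly
  \<open>\<rho>\<^sup>N\<close> (\<open>weight_of_injective_choice\<close>, \<open>N_const_identity\<close>).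

  For small \<open>\<kappa>\<close> the two bounds contradict each other. Hence all these determinants vanish, which
  places the set in a hyperplane (\<open>subset_affine_hyperplane_if_dets_vanish\<close>). The upper bound requires
  \<open>\<rho>\<close> to be below a threshold depending on \<open>V\<close> and \<open>\<Psi>\<close>; above it, a small \<open>\<kappa>\<close> leaves no admissible
  denominator at all.
\<close>

section \<open>Monomials\<close>

text \<open>
  Monomials in \<open>h\<close> are indexed by multisets of coordinates, so that the degree is the size, and
  multiplying by a coordinate adds an element.
\<close>

definition monom_at :: "'k multiset \<Rightarrow> real^'k \<Rightarrow> real" where
  "monom_at \<alpha> h = (\<Prod>i\<in>#\<alpha>. h $ i)"

lemma monom_at_empty [simp]: "monom_at {#} h = 1"
  by (simp add: monom_at_def)

lemma monom_at_add_mset [simp]: "monom_at (add_mset i \<alpha>) h = h $ i * monom_at \<alpha> h"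
  by (simp add: monom_at_def)

lemma monom_at_scaleR: "monom_at \<alpha> (t *\<^sub>R h) = t ^ size \<alpha> * monom_at \<alpha> h"
  by (induction \<alpha>) simp_all

lemma abs_monom_at_le: "\<bar>monom_at \<alpha> h\<bar> \<le> norm h ^ size \<alpha>"
proof (induction \<alpha>)
  case (add i \<alpha>)
  have "\<bar>h $ i\<bar> * \<bar>monom_at \<alpha> h\<bar> \<le> norm h * norm h ^ size \<alpha>"
    using add component_le_norm_cart[of h i] by (intro mult_mono) auto
  then show ?case by (simp add: abs_mult)
qed simp

lemma finite_multisets_size_less: "finite {\<alpha>::'k::finite multiset. size \<alpha> < n}"
proof -
  have "{\<alpha>::'k multiset. size \<alpha> < n} = (\<Union>j<n. multisets_of_size UNIV j)"
    by (auto simp: multisets_of_size_def)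
  then show ?thesis by (simp add: finite_multisets_of_size)
qed

text \<open>
  There are \<open>bracket (k - 1) j\<close> monomials of degree \<open>j\<close> in \<open>k\<close> variables. This is where the
  binomial coefficients in the definition of \<open>c(k,d)\<close> come from.
\<close>

lemma sum_multisets_size_less:
  fixes f :: "nat \<Rightarrow> nat"
  shows "(\<Sum>\<alpha> | size (\<alpha>::'k::finite multiset) < n. f (size \<alpha>)) = (\<Sum>j<n. f j * bracket (CARD('k) - 1) j)"
proof -
  have eq: "{\<alpha>::'k multiset. size \<alpha> < n} = (\<Union>j\<in>{..<n}. multisets_of_size UNIV j)"
    by (auto simp: multisets_of_size_def)
  have "(\<Sum>\<alpha> | size (\<alpha>::'k multiset) < n. f (size \<alpha>))
      = (\<Sum>j<n. \<Sum>\<alpha>\<in>multisets_of_size (UNIV::'k set) j. f (size \<alpha>))"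
    unfolding eq
    by (rule sum.UNION_disjoint) 
      (auto intro: finite_multisets_of_size simp: multisets_of_size_size, auto simp: multisets_of_size_def)
  also have "\<dots> = (\<Sum>j<n. f j * card (multisets_of_size (UNIV::'k set) j))"
    by (intro sum.cong refl) (simp add: multisets_of_size_def)
  also have "\<dots> = (\<Sum>j<n. f j * bracket (CARD('k) - 1) j)"
  proof (intro sum.cong refl)
    fix j
    have "CARD('k) + j - 1 = CARD('k) - 1 + j"
      using zero_less_card_finite[where 'a='k] by linarith
    then show "f j * card (multisets_of_size (UNIV::'k set) j) = f j * bracket (CARD('k) - 1) j"
      by (simp add: card_multisets_of_size bracket_def)
  qed
  finally show ?thesis .
qed

text \<open>
  Both sides run over the pairs consisting of a monomial \<open>\<beta>\<close> and a variable \<open>i\<close> dividing it,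
  described on the right by \<open>i\<close> and the quotient \<open>\<alpha>\<close>.
\<close>

lemma sum_multisets_remove_element:
  fixes G :: "'k::finite \<Rightarrow> 'k multiset \<Rightarrow> 'b::comm_monoid_add"
  shows "(\<Sum>\<beta> | size \<beta> < Suc n \<and> \<beta> \<noteq> {#}. \<Sum>i\<in>set_mset \<beta>. G i (\<beta> - {#i#}))
       = (\<Sum>i\<in>UNIV. \<Sum>\<alpha> | size \<alpha> < n. G i \<alpha>)"
proof -
  have fin: "finite {\<beta>::'k multiset. size \<beta> < Suc n \<and> \<beta> \<noteq> {#}}"
    by (rule finite_subset[OF _ finite_multisets_size_less[of "Suc n"]]) auto
  show ?thesis
    by (subst (1 2) sum.Sigma;
        (rule sum.reindex_bij_witness[where i = "\<lambda>(i, \<alpha>). (add_mset i \<alpha>, i)" and j = "\<lambda>(\<beta>, i). (i, \<beta> - {#i#})"])?)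
      (auto simp: fin finite_multisets_size_less size_Diff_singleton nonempty_has_size)
qed

section \<open>Taylor expansion with uniform remainder\<close>

lemma frechet_derivative_partials:
  fixes f :: "real^'k \<Rightarrow> 'b::real_normed_vector"
  assumes "f differentiable (at x)"
  shows "frechet_derivative f (at x) h = (\<Sum>i\<in>UNIV. h $ i *\<^sub>R frechet_derivative f (at x) (axis i 1))"
proof -
  have lin: "linear (frechet_derivative f (at x))"
    by (rule linear_frechet_derivative[OF assms])
  have "h = (\<Sum>i\<in>UNIV. h $ i *\<^sub>R axis i 1)"
    using basis_expansion[of h] by (simp add: scalar_mult_eq_scaleR)
  then have "frechet_derivative f (at x) h = frechet_derivative f (at x) (\<Sum>i\<in>UNIV. h $ i *\<^sub>R axis i 1)"
    by simp
  then show ?thesis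
    by (simp add: linear_sum[OF lin] linear_scale[OF lin])
qed

text \<open>
  The coefficients \<open>w\<close> are left unspecified: all that the determinant estimate needs is that they
  are bounded, and that a single constant serves for all base points \<open>x\<close> in \<open>S\<close>. Formulas for
  them in terms of iterated partial derivatives, and the symmetry of these, are thereby avoided.
\<close>

definition taylor_approx ::
    "nat \<Rightarrow> (real^'k) set \<Rightarrow> (real^'k \<Rightarrow> 'b::real_normed_vector) \<Rightarrow>
     ('k multiset \<Rightarrow> real^'k \<Rightarrow> 'b) \<Rightarrow> real \<Rightarrow> bool" where
  "taylor_approx n S f w C \<longleftrightarrow> 0 \<le> C \<and>
     (\<forall>\<alpha>. \<forall>x\<in>S. size \<alpha> < n \<longrightarrow> norm (w \<alpha> x) \<le> C) \<and>
     (\<forall>x\<in>S. \<forall>y\<in>S. norm (f y - (\<Sum>\<alpha> | size \<alpha> < n. monom_at \<alpha> (y - x) *\<^sub>R w \<alpha> x))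
        \<le> C * norm (y - x) ^ n)"

lemma power_Suc_scaleR_derivative:
  "((\<lambda>t. (t ^ Suc m * (c / real (Suc m))) *\<^sub>R u) has_vector_derivative (t ^ m * c) *\<^sub>R u) (at t within S)"
proof -
  have "((\<lambda>t. t ^ Suc m * (c / real (Suc m))) has_real_derivative (real (Suc m) * t ^ m) * (c / real (Suc m)))
      (at t within S)"
    by (rule DERIV_cmult_right) (use DERIV_pow[of "Suc m" t S] in \<open>simp\<close>)
  also have "(real (Suc m) * t ^ m) * (c / real (Suc m)) = t ^ m * c"
    by simp
  finally show ?thesis
    by (rule has_vector_derivative_scaleR[where g' = 0, OF _ has_vector_derivative_const, simplified])
qed

text \<open>
  Induction on the order, applied to the partial derivatives \<open>\<partial>\<^sub>i f\<close>. Their expansions at \<open>x\<close> are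
  integrated along the segment from \<open>x\<close> to \<open>y = x + h\<close>: the term \<open>\<alpha>\<close> of \<open>\<partial>\<^sub>i f\<close> contributes
  \<open>1 / (size \<alpha> + 1)\<close> times its coefficient to the coefficient of \<open>f\<close> at \<open>add_mset i \<alpha>\<close>.
  The difference \<open>g\<close> between \<open>f\<close> and the integrated expansion then has derivative of size
  \<open>norm h ^ Suc n\<close>, and the mean value inequality bounds its increment. Order \<open>0\<close> only
  says that \<open>f\<close> is bounded on \<open>S\<close>.
\<close>

lemma uniform_taylor_expansion:
  fixes f :: "real^'k \<Rightarrow> 'b::euclidean_space"
  assumes "compact S" "convex S" "S \<subseteq> W" "higher_differentiable_on n W f"
  shows "\<exists>w C. taylor_approx n S f w C"
  using assms(4)
proof (induction n arbitrary: f)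
  case 0
  then have "continuous_on S f"
    using assms(3) continuous_on_subset by auto
  then have "bounded (f ` S)"
    by (simp add: assms(1) compact_continuous_image compact_imp_bounded)
  then obtain C where "\<And>x. x \<in> S \<Longrightarrow> norm (f x) \<le> C"
    by (auto simp: bounded_iff)
  then show ?case
    by (intro exI[of _ "\<lambda>_ _. 0"] exI[of _ "max 0 C"])
      (auto simp: taylor_approx_def le_max_iff_disj)
next
  case (Suc n)
  let ?D = "\<lambda>i x. frechet_derivative f (at x) (axis i 1)"
  have diff: "\<And>x. x \<in> S \<Longrightarrow> f differentiable (at x)"
    using Suc.prems assms(3) by auto
  have "\<exists>w C. taylor_approx n S (?D i) w C" for i
    using Suc.IH Suc.prems by simp
  then obtain w C where wC': "\<And>i. taylor_approx n S (?D i) (w i) (C i)"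
    by metis
  have C0: "0 \<le> C i"
    and wC: "x \<in> S \<Longrightarrow> size \<alpha> < n \<Longrightarrow> norm (w i \<alpha> x) \<le> C i"
    and expand: "x \<in> S \<Longrightarrow> y \<in> S \<Longrightarrow>
        norm (?D i y - (\<Sum>\<alpha> | size \<alpha> < n. monom_at \<alpha> (y - x) *\<^sub>R w i \<alpha> x)) \<le> C i * norm (y - x) ^ n"
    for i \<alpha> x y
    using wC'[of i] by (auto simp: taylor_approx_def)
  have "continuous_on S f"
    using diff by (auto intro!: continuous_at_imp_continuous_on differentiable_imp_continuous_within)
  then have "bounded (f ` S)"
    by (simp add: assms(1) compact_continuous_image compact_imp_bounded)
  then obtain K where K: "\<And>x. x \<in> S \<Longrightarrow> norm (f x) \<le> K"
    by (auto simp: bounded_iff)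
  define CC where "CC = \<bar>K\<bar> + (\<Sum>i\<in>UNIV. C i)"
  have sumC0: "0 \<le> (\<Sum>i\<in>UNIV. C i)"
    by (simp add: C0 sum_nonneg)
  \<comment> \<open>The coefficients of the expansion of \<open>f\<close>, collected from those of the \<open>\<partial>\<^sub>i f\<close>.\<close>
  define v where "v \<beta> x = (if \<beta> = {#} then f x
      else (\<Sum>i\<in>set_mset \<beta>. w i (\<beta> - {#i#}) x /\<^sub>R real (size \<beta>)))" for \<beta> x
  have v_bound: "norm (v \<beta> x) \<le> CC" if "x \<in> S" "size \<beta> < Suc n" for \<beta> x
  proof (cases "\<beta> = {#}")
    case True
    then show ?thesis
      using K[OF that(1)] sumC0 by (simp add: v_def CC_def)
  next
    case False
    then have size1: "1 \<le> real (size \<beta>)"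
      by (metis One_nat_def Suc_leI nonempty_has_size of_nat_1 of_nat_le_iff)
    have "norm (w i (\<beta> - {#i#}) x /\<^sub>R real (size \<beta>)) \<le> C i" if "i \<in># \<beta>" for i
    proof -
      have "norm (w i (\<beta> - {#i#}) x) \<le> C i"
        using \<open>x \<in> S\<close> \<open>size \<beta> < Suc n\<close> that False by (intro wC) (auto simp: size_Diff_singleton nonempty_has_size)
      moreover have "norm (w i (\<beta> - {#i#}) x) / real (size \<beta>) \<le> norm (w i (\<beta> - {#i#}) x)"
        using size1 by (simp add: divide_le_eq mult_left_le_one_le mult_le_cancel_left1)
      ultimately show ?thesis
        by (simp add: divide_inverse mult.commute)
    qed
    then have "norm (v \<beta> x) \<le> (\<Sum>i\<in>set_mset \<beta>. C i)"
      unfolding v_def using False by (simp add: sum_norm_le)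
    also have "\<dots> \<le> (\<Sum>i\<in>UNIV. C i)"
      by (rule sum_mono2) (auto simp: C0)
    finally show ?thesis by (simp add: CC_def)
  qed
  have v_expand: "norm (f y - (\<Sum>\<beta> | size \<beta> < Suc n. monom_at \<beta> (y - x) *\<^sub>R v \<beta> x))
      \<le> CC * norm (y - x) ^ Suc n" if xy: "x \<in> S" "y \<in> S" for x y
  proof -
    define h where "h = y - x"
    \<comment> \<open>The nonconstant part of the Taylor polynomial of \<open>f\<close> at \<open>x\<close>, along the segment.\<close>
    define T where "T t = (\<Sum>i\<in>UNIV. \<Sum>\<alpha> | size \<alpha> < n.
        (t ^ Suc (size \<alpha>) * (h $ i * monom_at \<alpha> h / real (Suc (size \<alpha>)))) *\<^sub>R w i \<alpha> x)" for t
    have T1: "(\<Sum>\<beta> | size \<beta> < Suc n. monom_at \<beta> h *\<^sub>R v \<beta> x) = f x + T 1"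
    proof -
      have "(\<Sum>\<beta> | size \<beta> < Suc n. monom_at \<beta> h *\<^sub>R v \<beta> x)
          = monom_at {#} h *\<^sub>R v {#} x + (\<Sum>\<beta>\<in>{\<beta>. size \<beta> < Suc n} - {{#}}. monom_at \<beta> h *\<^sub>R v \<beta> x)"
        by (rule sum.remove) (auto intro: finite_multisets_size_less)
      also have "{\<beta>::'k multiset. size \<beta> < Suc n} - {{#}} = {\<beta>. size \<beta> < Suc n \<and> \<beta> \<noteq> {#}}"
        by auto
      also have "(\<Sum>\<beta> | size \<beta> < Suc n \<and> \<beta> \<noteq> {#}. monom_at \<beta> h *\<^sub>R v \<beta> x)
          = (\<Sum>\<beta> | size \<beta> < Suc n \<and> \<beta> \<noteq> {#}. \<Sum>i\<in>set_mset \<beta>.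
              (\<lambda>i \<alpha>. (h $ i * monom_at \<alpha> h / real (Suc (size \<alpha>))) *\<^sub>R w i \<alpha> x) i (\<beta> - {#i#}))"
      proof (intro sum.cong refl)
        fix \<beta> :: "'k multiset"
        assume \<beta>: "\<beta> \<in> {\<beta>. size \<beta> < Suc n \<and> \<beta> \<noteq> {#}}"
        have "monom_at \<beta> h *\<^sub>R (w i (\<beta> - {#i#}) x /\<^sub>R real (size \<beta>)) =
            (h $ i * monom_at (\<beta> - {#i#}) h / real (Suc (size (\<beta> - {#i#})))) *\<^sub>R w i (\<beta> - {#i#}) x"
          if "i \<in># \<beta>" for i
        proof -
          have m: "monom_at \<beta> h = h $ i * monom_at (\<beta> - {#i#}) h"
            using monom_at_add_mset[of i "\<beta> - {#i#}" h] that by simp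
          have s: "size \<beta> = Suc (size (\<beta> - {#i#}))"
            using size_add_mset[of i "\<beta> - {#i#}"] that by simp
          show ?thesis
            unfolding m s by (simp add: divide_inverse)
        qed
        note summand = this
        have "v \<beta> x = (\<Sum>i\<in>set_mset \<beta>. w i (\<beta> - {#i#}) x /\<^sub>R real (size \<beta>))"
          using \<beta> by (simp add: v_def)
        then show "monom_at \<beta> h *\<^sub>R v \<beta> x = (\<Sum>i\<in>set_mset \<beta>.
              (\<lambda>i \<alpha>. (h $ i * monom_at \<alpha> h / real (Suc (size \<alpha>))) *\<^sub>R w i \<alpha> x) i (\<beta> - {#i#}))"
          by (simp only: scaleR_sum_right) (intro sum.cong refl summand)
      qed
      also have "\<dots> = T 1"
        using sum_multisets_remove_element[where n = n and
            G = "\<lambda>i \<alpha>. (h $ i * monom_at \<alpha> h / real (Suc (size \<alpha>))) *\<^sub>R w i \<alpha> x"]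
        by (simp add: T_def)
      finally show ?thesis by (simp add: v_def)
    qed
    define g where "g t = f (x + t *\<^sub>R h) - T t" for t
    define g' where "g' t = (\<Sum>i\<in>UNIV. h $ i *\<^sub>R (?D i (x + t *\<^sub>R h)
        - (\<Sum>\<alpha> | size \<alpha> < n. monom_at \<alpha> (t *\<^sub>R h) *\<^sub>R w i \<alpha> x)))" for t
    have in_S: "x + t *\<^sub>R h \<in> S" if "t \<in> {0..1}" for t
    proof -
      have "(1 - t) *\<^sub>R x + t *\<^sub>R y \<in> S"
        using assms(2) xy that by (auto intro!: convexD)
      then show ?thesis by (simp add: h_def algebra_simps)
    qed
    have deriv: "(g has_vector_derivative g' t) (at t within {0..1})" if t: "t \<in> {0..1}" for t
    proof -
      have "(f has_derivative frechet_derivative f (at (x + t *\<^sub>R h))) (at (x + t *\<^sub>R h))"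
        using diff[OF in_S[OF t]] frechet_derivative_works by blast
      moreover have "((\<lambda>t. x + t *\<^sub>R h) has_derivative (\<lambda>s. s *\<^sub>R h)) (at t within {0..1})"
        by (auto intro!: derivative_eq_intros)
      ultimately have "((\<lambda>t. f (x + t *\<^sub>R h)) has_derivative
          (\<lambda>s. frechet_derivative f (at (x + t *\<^sub>R h)) (s *\<^sub>R h))) (at t within {0..1})"
        by (rule has_derivative_compose[rotated])
      then have "((\<lambda>t. f (x + t *\<^sub>R h)) has_vector_derivative frechet_derivative f (at (x + t *\<^sub>R h)) h)
          (at t within {0..1})"
        unfolding has_vector_derivative_def
        by (simp add: linear_scale[OF linear_frechet_derivative[OF diff[OF in_S[OF t]]]])
      moreover have "(T has_vector_derivative (\<Sum>i\<in>UNIV. \<Sum>\<alpha> | size \<alpha> < n.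
          (t ^ size \<alpha> * (h $ i * monom_at \<alpha> h)) *\<^sub>R w i \<alpha> x)) (at t within {0..1})"
        unfolding T_def by (intro has_vector_derivative_sum power_Suc_scaleR_derivative)
      ultimately have "(g has_vector_derivative frechet_derivative f (at (x + t *\<^sub>R h)) h - (\<Sum>i\<in>UNIV. \<Sum>\<alpha> | size \<alpha> < n.
          (t ^ size \<alpha> * (h $ i * monom_at \<alpha> h)) *\<^sub>R w i \<alpha> x)) (at t within {0..1})"
        unfolding g_def by (rule has_vector_derivative_diff)
      moreover have "frechet_derivative f (at (x + t *\<^sub>R h)) h - (\<Sum>i\<in>UNIV. \<Sum>\<alpha> | size \<alpha> < n.
          (t ^ size \<alpha> * (h $ i * monom_at \<alpha> h)) *\<^sub>R w i \<alpha> x) = g' t"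
        unfolding g'_def frechet_derivative_partials[OF diff[OF in_S[OF t]], of h]
        by (simp add: scaleR_diff_right sum_subtractf scaleR_sum_right monom_at_scaleR mult_ac)
      ultimately show ?thesis by simp
    qed
    have g'_bound: "norm (g' t) \<le> CC * norm h ^ Suc n" if t: "t \<in> {0..1}" for t
    proof -
      have "norm (h $ i *\<^sub>R (?D i (x + t *\<^sub>R h) - (\<Sum>\<alpha> | size \<alpha> < n. monom_at \<alpha> (t *\<^sub>R h) *\<^sub>R w i \<alpha> x)))
          \<le> C i * norm h ^ Suc n" for i
      proof -
        have "norm (?D i (x + t *\<^sub>R h) - (\<Sum>\<alpha> | size \<alpha> < n. monom_at \<alpha> (t *\<^sub>R h) *\<^sub>R w i \<alpha> x))
            \<le> C i * norm (t *\<^sub>R h) ^ n"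
          using expand[OF xy(1) in_S[OF t], of i] by simp
        also have "\<dots> \<le> C i * norm h ^ n"
          using t by (intro mult_left_mono power_mono C0) (auto intro: mult_left_le_one_le)
        finally have "\<bar>h $ i\<bar> * norm (?D i (x + t *\<^sub>R h) - (\<Sum>\<alpha> | size \<alpha> < n. monom_at \<alpha> (t *\<^sub>R h) *\<^sub>R w i \<alpha> x))
            \<le> norm h * (C i * norm h ^ n)"
          by (intro mult_mono component_le_norm_cart) auto
        then show ?thesis by (simp add: mult_ac)
      qed
      then have "norm (g' t) \<le> (\<Sum>i\<in>UNIV. C i * norm h ^ Suc n)"
        unfolding g'_def by (rule sum_norm_le)
      also have "\<dots> \<le> CC * norm h ^ Suc n"
        unfolding CC_def sum_distrib_right[symmetric] by (intro mult_right_mono) auto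
      finally show ?thesis .
    qed
    have "norm (g 1 - g 0) \<le> (CC * norm h ^ Suc n) * norm (1 - 0 :: real)"
    proof (rule differentiable_bound)
      show "(g has_derivative (\<lambda>s. s *\<^sub>R g' t)) (at t within {0..1})" if "t \<in> {0..1}" for t
        using deriv[OF that] by (simp add: has_vector_derivative_def)
      show "onorm (\<lambda>s. s *\<^sub>R g' t) \<le> CC * norm h ^ Suc n" if "t \<in> {0..1}" for t
        using g'_bound[OF that] by (intro onorm_le) (simp add: mult.commute mult_left_mono)
    qed auto
    moreover have "g 1 = f y - T 1" "g 0 = f x"
      by (simp_all add: g_def h_def T_def)
    ultimately show ?thesis
      unfolding h_def[symmetric] T1 by (simp add: algebra_simps)
  qed
  have "0 \<le> CC"
    using sumC0 by (simp add: CC_def)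
  then show ?case
    unfolding taylor_approx_def using v_bound v_expand by blast
qed

section \<open>Determinants whose rows are graded sums\<close>

lemma det_rows_sum:
  fixes v :: "'n::finite \<Rightarrow> 'i \<Rightarrow> real^'n"
  assumes "finite I"
  shows "det (\<chi> i. \<Sum>a\<in>I. v i a) = (\<Sum>f\<in>UNIV \<rightarrow>\<^sub>E I. det (\<chi> i. v i (f i)))"
proof -
  have "det (\<chi> i. \<Sum>a\<in>I. v i a)
      = (\<Sum>p | p permutes UNIV. of_int (sign p) * (\<Sum>f\<in>UNIV \<rightarrow>\<^sub>E I. \<Prod>i\<in>UNIV. v i (f i) $ p i))"
    unfolding det_def using assms by (simp add: prod_sum_PiE)
  also have "\<dots> = (\<Sum>f\<in>UNIV \<rightarrow>\<^sub>E I. \<Sum>p | p permutes UNIV. of_int (sign p) * (\<Prod>i\<in>UNIV. v i (f i) $ p i))"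
    by (simp add: sum_distrib_left) (rule sum.swap)
  finally show ?thesis by (simp add: det_def)
qed

lemma abs_det_le_prod_rows:
  fixes A :: "real^'n^'n"
  assumes "\<And>i j. \<bar>A $ i $ j\<bar> \<le> b i"
  shows "\<bar>det A\<bar> \<le> fact CARD('n) * (\<Prod>i\<in>UNIV. b i)"
proof -
  have "\<bar>det A\<bar> \<le> (\<Sum>p | p permutes (UNIV::'n set). \<bar>of_int (sign p) * (\<Prod>i\<in>UNIV. A $ i $ p i)\<bar>)"
    unfolding det_def by (rule sum_abs)
  also have "\<dots> \<le> (\<Sum>p | p permutes (UNIV::'n set). \<Prod>i\<in>UNIV. b i)"
    by (intro sum_mono) (auto simp: abs_mult sign_def abs_prod intro!: prod_mono assms)
  also have "\<dots> = fact CARD('n) * (\<Prod>i\<in>UNIV. b i)"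
    by (simp add: card_permutations)
  finally show ?thesis .
qed

text \<open>
  Every row is a sum of terms labelled by \<open>I\<close>, the term with label \<open>a\<close> being of order
  \<open>t ^ D a\<close>. After multilinear expansion only the choices \<open>f\<close> of one label per row with nonzero
  determinant matter, so a lower bound \<open>N\<close> for their total degree makes the determinant of order
  \<open>t ^ N\<close>. The constant depends on \<open>B\<close> and on cardinalities only, hence not on the rows.
\<close>

lemma abs_det_le_graded:
  fixes v :: "'n::finite \<Rightarrow> 'i \<Rightarrow> real^'n"
  assumes "finite I" and t: "0 \<le> t" "t \<le> 1" and "0 \<le> B"
    and bound: "\<And>i a j. a \<in> I \<Longrightarrow> \<bar>v i a $ j\<bar> \<le> B * t ^ D a"
    and weight: "\<And>f. f \<in> UNIV \<rightarrow>\<^sub>E I \<Longrightarrow> det (\<chi> i. v i (f i)) \<noteq> 0 \<Longrightarrow> N \<le> (\<Sum>i\<in>UNIV. D (f i))"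
  shows "\<bar>det (\<chi> i. \<Sum>a\<in>I. v i a)\<bar> \<le> real (card I ^ CARD('n)) * (fact CARD('n) * B ^ CARD('n)) * t ^ N"
proof -
  let ?K = "fact CARD('n) * B ^ CARD('n) * t ^ N"
  have K0: "0 \<le> ?K"
    using t \<open>0 \<le> B\<close> by simp
  have summand: "\<bar>det (\<chi> i. v i (f i))\<bar> \<le> ?K" if f: "f \<in> UNIV \<rightarrow>\<^sub>E I" for f
  proof (cases "det (\<chi> i. v i (f i)) = 0")
    case True
    then show ?thesis using K0 by simp
  next
    case False
    have "\<bar>det (\<chi> i. v i (f i))\<bar> \<le> fact CARD('n) * (\<Prod>i\<in>UNIV. B * t ^ D (f i))"
      using f by (intro abs_det_le_prod_rows) (auto intro!: bound)
    also have "(\<Prod>i\<in>UNIV. B * t ^ D (f i)) = B ^ CARD('n) * t ^ (\<Sum>i\<in>UNIV. D (f i))"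
      by (simp add: prod.distrib power_sum)
    also have "fact CARD('n) * (B ^ CARD('n) * t ^ (\<Sum>i\<in>UNIV. D (f i))) \<le> fact CARD('n) * (B ^ CARD('n) * t ^ N)"
      using weight[OF f False] t \<open>0 \<le> B\<close> by (intro mult_left_mono power_decreasing) auto
    finally show ?thesis by (simp add: mult_ac)
  qed
  have "\<bar>det (\<chi> i. \<Sum>a\<in>I. v i a)\<bar> \<le> (\<Sum>f\<in>UNIV \<rightarrow>\<^sub>E I. \<bar>det (\<chi> i. v i (f i))\<bar>)"
    unfolding det_rows_sum[OF \<open>finite I\<close>] by (rule sum_abs)
  also have "\<dots> \<le> real (card (UNIV \<rightarrow>\<^sub>E I :: ('n \<Rightarrow> 'i) set)) * ?K"
    by (intro sum_bounded_above summand)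
  also have "card (UNIV \<rightarrow>\<^sub>E I :: ('n \<Rightarrow> 'i) set) = card I ^ CARD('n)"
    by (simp add: card_PiE)
  finally show ?thesis by (simp add: mult_ac)
qed

text \<open>
  The labels are those of a Taylor expansion: \<open>Some a\<close> for the monomials, all of degree at most \<open>m\<close>,
  and \<open>None\<close> for the remainder, of degree \<open>m\<close>. Measured by the deficit \<open>m - degree\<close>, the remainder
  counts for nothing, and a choice that uses no monomial twice has total deficit at most that of all
  monomials together.
\<close>

lemma weight_of_injective_choice:
  fixes f :: "'n::finite \<Rightarrow> 'i option" and deg :: "'i \<Rightarrow> nat"
  assumes "finite I" and range: "\<And>i. f i \<in> insert None (Some ` I)"
    and inj: "inj_on f {i. f i \<noteq> None}"
    and deg: "\<And>a. a \<in> I \<Longrightarrow> deg a \<le> m"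
  shows "CARD('n) * m \<le> (\<Sum>i\<in>UNIV. case_option m deg (f i)) + (\<Sum>a\<in>I. m - deg a)"
proof -
  let ?D = "case_option m deg"
  let ?J = "{i. f i \<noteq> None}"
  have le: "?D (f i) \<le> m" for i
    using range[of i] deg by (auto split: option.splits)
  have "CARD('n) * m = (\<Sum>i\<in>(UNIV::'n set). ?D (f i) + (m - ?D (f i)))"
    using le by simp
  also have "\<dots> = (\<Sum>i\<in>UNIV. ?D (f i)) + (\<Sum>i\<in>UNIV. m - ?D (f i))"
    by (rule sum.distrib)
  also have "(\<Sum>i\<in>UNIV. m - ?D (f i)) = (\<Sum>i\<in>?J. m - deg (the (f i)))"
    by (rule sum.mono_neutral_cong_right) (auto split: option.splits)
  also have "\<dots> = (\<Sum>a\<in>(\<lambda>i. the (f i)) ` ?J. m - deg a)"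
    by (subst sum.reindex) (use inj in \<open>auto simp: inj_on_def\<close>)
  also have "\<dots> \<le> (\<Sum>a\<in>I. m - deg a)"
  proof (rule sum_mono2[OF \<open>finite I\<close>])
    show "(\<lambda>i. the (f i)) ` ?J \<subseteq> I"
    proof
      fix a assume "a \<in> (\<lambda>i. the (f i)) ` ?J"
      then obtain i where "f i = Some a" by auto
      then show "a \<in> I" using range[of i] by auto
    qed
  qed simp
  finally show ?thesis by simp
qed

section \<open>The exponent \<open>N(k,d)\<close>\<close>

text \<open>
  Let \<open>n = n_const k d\<close>. With \<open>n + 1\<close> in place of \<open>m\<close> in \<open>weight_of_injective_choice\<close> and \<open>d + 1\<close> rows, the least total degree allowed by the deficit count
  is attained by using every monomial of degree at most \<open>n\<close> once and the remainder in the other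
  \<open>m_const k d\<close> rows; its value is \<open>N_const k d\<close>.
\<close>

lemma N_const_identity:
  assumes "1 \<le> k" "k \<le> d"
  shows "(d + 1) * Suc (n_const k d)
       = N_const k d + (\<Sum>j<Suc (n_const k d). (Suc (n_const k d) - j) * bracket (k - 1) j)"
proof -
  define n where "n = n_const k d"
  let ?P = "\<lambda>n. n \<ge> 1 \<and> (\<exists>m. d = (\<Sum>i=1..n. bracket (k - 1) i) + m)"
  have "?P n"
    unfolding n_def n_const_def
  proof (rule GreatestI_nat)
    have "bracket (k - 1) 1 = k"
      using assms by (simp add: bracket_def)
    then show "?P 1"
      using assms by (simp add: le_iff_add)
    fix l assume "?P l"
    then obtain m where m: "d = (\<Sum>i=1..l. bracket (k - 1) i) + m" by blast
    have "l = (\<Sum>i=1..l. 1)" by simp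
    also have "\<dots> \<le> (\<Sum>i=1..l. bracket (k - 1) i)"
      by (intro sum_mono) (simp add: bracket_def Suc_le_eq)
    finally show "l \<le> d" using m by simp
  qed
  then obtain m where m: "d = (\<Sum>i=1..n. bracket (k - 1) i) + m" by blast
  have m_const: "m_const k d = m"
    unfolding m_const_def n_def[symmetric] using m by (intro the_equality) auto
  have split: "(\<Sum>j<Suc n. g j) = g 0 + (\<Sum>j=1..n. g j)" for g :: "nat \<Rightarrow> nat"
    by (simp add: lessThan_Suc_atMost atMost_atLeast0 sum.atLeast_Suc_atMost)
  have d: "d + 1 = (\<Sum>j<Suc n. bracket (k - 1) j) + m"
    using m split[of "bracket (k - 1)"] by (simp add: bracket_def)
  have N: "N_const k d = (\<Sum>j<Suc n. j * bracket (k - 1) j) + Suc n * m"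
    unfolding N_const_def m_const n_def[symmetric] using split[of "\<lambda>j. j * bracket (k - 1) j"] by simp
  have "(\<Sum>j<Suc n. bracket (k - 1) j) * Suc n
      = (\<Sum>j<Suc n. j * bracket (k - 1) j) + (\<Sum>j<Suc n. (Suc n - j) * bracket (k - 1) j)"
    unfolding sum_distrib_right sum.distrib[symmetric]
    by (intro sum.cong refl) (auto simp: add_mult_distrib[symmetric] mult.commute)
  then show ?thesis
    unfolding n_def[symmetric] N d by (simp only: add_mult_distrib) (simp add: algebra_simps)
qed

section \<open>Determinants of nearby points\<close>

text \<open>
  Homogeneous coordinates, with the extra coordinate \<open>1\<close> at \<open>None\<close>: \<open>d + 1\<close> points of \<open>d\<close>-space are
  affinely dependent iff the determinant of their homogenizations vanishes.
\<close>

definition homogenize :: "real^'d \<Rightarrow> real^'d option" where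
  "homogenize x = (\<chi> j. case j of None \<Rightarrow> 1 | Some j \<Rightarrow> x $ j)"

text \<open>
  Expand all points around one of them, \<open>x = z None\<close>. The coefficient vectors of the monomials
  are the same in all rows, so a choice that takes the same monomial in two rows has proportional
  rows and determinant \<open>0\<close>. The remaining choices have total degree at least \<open>N\<close> by
  \<open>weight_of_injective_choice\<close>.
\<close>

lemma local_det_bound:
  fixes g :: "real^'k \<Rightarrow> real^'d"
  assumes S: "compact S" "convex S" "S \<subseteq> W" and g: "higher_differentiable_on n W g"
    and N: "CARD('d option) * n = N + (\<Sum>\<alpha> | size (\<alpha>::'k multiset) < n. n - size \<alpha>)"
  shows "\<exists>C\<ge>0. \<forall>(z :: 'd option \<Rightarrow> real^'k) t. 0 \<le> t \<longrightarrow> t \<le> 1 \<longrightarrow> range z \<subseteq> S \<longrightarrow>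
      (\<forall>i j. norm (z i - z j) \<le> t) \<longrightarrow> \<bar>det (\<chi> i. homogenize (g (z i)))\<bar> \<le> C * t ^ N"
proof -
  obtain w B where wB: "taylor_approx n S g w B"
    using uniform_taylor_expansion[OF S g] by blast
  then have B0: "0 \<le> B"
    and w: "x \<in> S \<Longrightarrow> size \<alpha> < n \<Longrightarrow> norm (w \<alpha> x) \<le> B"
    and R: "x \<in> S \<Longrightarrow> y \<in> S \<Longrightarrow>
      norm (g y - (\<Sum>\<alpha> | size \<alpha> < n. monom_at \<alpha> (y - x) *\<^sub>R w \<alpha> x)) \<le> B * norm (y - x) ^ n" for \<alpha> x y
    by (auto simp: taylor_approx_def)
  let ?A = "{\<alpha>::'k multiset. size \<alpha> < n}"
  let ?I = "insert None (Some ` ?A)"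
  have finA: "finite ?A"
    by (rule finite_multisets_size_less)
  then have finI: "finite ?I" by simp
  define C where "C = real (card ?I ^ CARD('d option)) * (fact CARD('d option) * (1 + B) ^ CARD('d option))"
  show ?thesis
  proof (intro exI[of _ C] conjI allI impI)
    show "0 \<le> C"
      using B0 by (simp add: C_def)
  next
    fix z :: "'d option \<Rightarrow> real^'k" and t :: real
    assume t: "0 \<le> t" "t \<le> 1" and z: "range z \<subseteq> S" and dist': "\<forall>i j. norm (z i - z j) \<le> t"
    have dist: "\<And>i j. norm (z i - z j) \<le> t" using dist' by blast
    define x where "x = z None"
    have xS: "x \<in> S" and zS: "\<And>i. z i \<in> S"
      using z by (auto simp: x_def)
    \<comment> \<open>The homogenized coefficients: the extra coordinate of a point is the constant polynomial \<open>1\<close>.\<close>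
    define W' where "W' \<alpha> = (\<chi> j. case j of None \<Rightarrow> (if \<alpha> = {#} then 1 else 0) | Some j \<Rightarrow> w \<alpha> x $ j)" for \<alpha>
    define r where "r i = g (z i) - (\<Sum>\<alpha>\<in>?A. monom_at \<alpha> (z i - x) *\<^sub>R w \<alpha> x)" for i
    \<comment> \<open>For \<open>n = 0\<close> there are no monomials at all, not even the constant one that carries the extra
        coordinate; the remainder is then the whole row.\<close>
    define v where "v i a = (case a of
        None \<Rightarrow> if n = 0 then homogenize (g (z i)) else (\<chi> j. case j of None \<Rightarrow> 0 | Some j \<Rightarrow> r i $ j)
      | Some \<alpha> \<Rightarrow> monom_at \<alpha> (z i - x) *\<^sub>R W' \<alpha>)" for i a
    have rows: "homogenize (g (z i)) = (\<Sum>a\<in>?I. v i a)" for i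
    proof (cases "n = 0")
      case True
      then show ?thesis by (simp add: v_def)
    next
      case False
      have "(\<Sum>a\<in>?I. v i a) = v i None + (\<Sum>\<alpha>\<in>?A. v i (Some \<alpha>))"
        using finA by (simp add: sum.reindex)
      moreover have "(v i None + (\<Sum>\<alpha>\<in>?A. v i (Some \<alpha>))) $ j = homogenize (g (z i)) $ j" for j
      proof (cases j)
        case None
        have "(\<Sum>\<alpha>\<in>?A. v i (Some \<alpha>) $ None) = (\<Sum>\<alpha>\<in>?A. if \<alpha> = {#} then 1 else 0)"
          by (intro sum.cong refl) (auto simp: v_def W'_def)
        also have "\<dots> = 1"
          using finA False by simp
        finally show ?thesis
          using None False by (simp add: v_def homogenize_def)
      next
        case (Some j')
        then show ?thesis
          using False by (simp add: v_def homogenize_def r_def W'_def)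
      qed
      ultimately show ?thesis by (simp add: vec_eq_iff)
    qed
    have hn: "norm (z i - x) \<le> t" for i
      unfolding x_def by (rule dist)
    have "\<bar>det (\<chi> i. \<Sum>a\<in>?I. v i a)\<bar> \<le> C * t ^ N"
      unfolding C_def
    proof (rule abs_det_le_graded[where D = "case_option n size"])
      show "finite ?I" "0 \<le> t" "t \<le> 1" "0 \<le> 1 + B"
        using finI t B0 by auto
    next
      fix i j a assume a: "a \<in> ?I"
      show "\<bar>v i a $ j\<bar> \<le> (1 + B) * t ^ case_option n size a"
      proof (cases a)
        case None
        have "\<bar>r i $ j'\<bar> \<le> (1 + B) * t ^ n" for j'
        proof -
          have "\<bar>r i $ j'\<bar> \<le> norm (r i)" by (rule component_le_norm_cart)
          also have "\<dots> \<le> B * norm (z i - x) ^ n"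
            unfolding r_def using R[OF xS zS[of i]] .
          also have "\<dots> \<le> (1 + B) * t ^ n"
            using hn[of i] B0 by (intro mult_mono power_mono) auto
          finally show ?thesis .
        qed
        then show ?thesis
          using None B0 t by (auto simp: v_def homogenize_def r_def split: option.splits)
      next
        case (Some \<alpha>)
        then have \<alpha>: "size \<alpha> < n" using a by auto
        have "\<bar>W' \<alpha> $ j\<bar> \<le> 1 + B"
        proof (cases j)
          case (Some j')
          then show ?thesis
            using w[OF xS \<alpha>] component_le_norm_cart[of "w \<alpha> x" j'] by (simp add: W'_def)
        qed (use B0 in \<open>simp add: W'_def\<close>)
        moreover have "\<bar>monom_at \<alpha> (z i - x)\<bar> \<le> t ^ size \<alpha>"
          using abs_monom_at_le[of \<alpha> "z i - x"] power_mono[OF hn[of i], of "size \<alpha>"] by simp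
        ultimately have "\<bar>monom_at \<alpha> (z i - x)\<bar> * \<bar>W' \<alpha> $ j\<bar> \<le> t ^ size \<alpha> * (1 + B)"
          using t by (intro mult_mono) auto
        then show ?thesis
          by (simp add: Some v_def abs_mult mult.commute)
      qed
    next
      fix f :: "'d option \<Rightarrow> 'k multiset option"
      assume f: "f \<in> UNIV \<rightarrow>\<^sub>E ?I" and nz: "det (\<chi> i. v i (f i)) \<noteq> 0"
      have "inj_on f {i. f i \<noteq> None}"
      proof (rule inj_onI, rule ccontr)
        fix i i' assume i: "i \<in> {i. f i \<noteq> None}" "i' \<in> {i. f i \<noteq> None}" "f i = f i'" "i \<noteq> i'"
        then obtain \<alpha> where \<alpha>: "f i = Some \<alpha>" "f i' = Some \<alpha>" by auto
        \<comment> \<open>The monomial factors \<open>c\<close> are pulled out of the rows with label \<open>\<alpha>\<close>, which leaves two equal rows.\<close>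
        define c where "c l = (if f l = Some \<alpha> then monom_at \<alpha> (z l - x) else 1)" for l
        define u where "u l = (if f l = Some \<alpha> then W' \<alpha> else v l (f l))" for l
        have "(\<chi> l. v l (f l)) = (\<chi> l. c l *s u l)"
          by (simp add: vec_eq_iff c_def u_def v_def)
        moreover have "det (\<chi> l. u l) = 0"
          by (rule det_identical_rows[OF \<open>i \<noteq> i'\<close>]) (simp add: row_def u_def \<alpha>)
        ultimately show False
          using nz by (simp add: det_rows_mul)
      qed
      then have "CARD('d option) * n \<le> (\<Sum>i\<in>UNIV. case_option n size (f i)) + (\<Sum>\<alpha>\<in>?A. n - size \<alpha>)"
        using f by (intro weight_of_injective_choice finA) (auto simp: PiE_iff)
      then show "N \<le> (\<Sum>i\<in>UNIV. case_option n size (f i))"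
        using N by linarith
    qed
    then show "\<bar>det (\<chi> i. homogenize (g (z i)))\<bar> \<le> C * t ^ N"
      by (simp add: rows)
  qed
qed

text \<open>
  The local bounds hold on balls that cover \<open>V\<close>. Below a Lebesgue number of a finite subcover, any
  tuple of nearby points lies in one of these balls. In particular the segments used in the Taylor
  expansion never leave \<open>U\<close>.
\<close>

lemma uniform_det_bound:
  fixes \<Psi> :: "real^'k \<Rightarrow> real^'d"
  assumes "open U" "smooth_map_on U \<Psi>" "compact V" "V \<subseteq> U"
    and N: "CARD('d option) * n = N + (\<Sum>\<alpha> | size (\<alpha>::'k multiset) < n. n - size \<alpha>)"
  obtains \<delta> C where "0 < \<delta>" "0 \<le> C"
    "\<And>(z :: 'd option \<Rightarrow> real^'k) t. \<lbrakk>0 \<le> t; t < \<delta>; range z \<subseteq> V; \<And>i j. norm (z i - z j) \<le> t\<rbrakk> \<Longrightarrow>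
        \<bar>det (\<chi> i. homogenize (\<Psi> (z i)))\<bar> \<le> C * t ^ N"
proof -
  have "\<exists>r C. 0 < r \<and> 0 \<le> C \<and> (\<forall>(z :: 'd option \<Rightarrow> real^'k) t. 0 \<le> t \<longrightarrow> t \<le> 1 \<longrightarrow> range z \<subseteq> ball x r \<longrightarrow>
      (\<forall>i j. norm (z i - z j) \<le> t) \<longrightarrow> \<bar>det (\<chi> i. homogenize (\<Psi> (z i)))\<bar> \<le> C * t ^ N)" if "x \<in> V" for x
  proof -
    obtain W g where W: "x \<in> W" "smooth_on_open W g" "\<And>y. y \<in> U \<inter> W \<Longrightarrow> g y = \<Psi> y"
      using assms(2,4) \<open>x \<in> V\<close> unfolding smooth_map_on_def by (metis subsetD)
    then have "open (U \<inter> W)" "x \<in> U \<inter> W" and diff: "higher_differentiable_on n W g"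
      using assms(1,4) \<open>x \<in> V\<close> by (auto simp: smooth_on_open_def)
    then obtain r where r: "0 < r" "cball x r \<subseteq> U \<inter> W"
      using open_contains_cball by metis
    then have rW: "cball x r \<subseteq> W" by blast
    obtain C where C: "0 \<le> C"
      "\<forall>(z :: 'd option \<Rightarrow> real^'k) t. 0 \<le> t \<longrightarrow> t \<le> 1 \<longrightarrow> range z \<subseteq> cball x r \<longrightarrow>
        (\<forall>i j. norm (z i - z j) \<le> t) \<longrightarrow> \<bar>det (\<chi> i. homogenize (g (z i)))\<bar> \<le> C * t ^ N"
      using local_det_bound[OF compact_cball convex_cball rW diff N] by blast
    have "\<bar>det (\<chi> i. homogenize (\<Psi> (z i)))\<bar> \<le> C * t ^ N"
      if "0 \<le> t" "t \<le> 1" "range z \<subseteq> ball x r" "\<forall>i j. norm (z i - z j) \<le> t"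
      for z :: "'d option \<Rightarrow> real^'k" and t
    proof -
      have "range z \<subseteq> cball x r"
        using that(3) ball_subset_cball by blast
      moreover from this have "g (z i) = \<Psi> (z i)" for i
        using r(2) W(3) by blast
      ultimately show ?thesis
        using C(2)[rule_format, of t z] that by simp
    qed
    with r(1) C(1) show ?thesis by blast
  qed
  then obtain r C where r: "\<And>x. x \<in> V \<Longrightarrow> 0 < r x" and C0: "\<And>x. x \<in> V \<Longrightarrow> 0 \<le> C x"
    and C: "\<And>x (z :: 'd option \<Rightarrow> real^'k) t. \<lbrakk>x \<in> V; 0 \<le> t; t \<le> 1; range z \<subseteq> ball x (r x);
      \<And>i j. norm (z i - z j) \<le> t\<rbrakk> \<Longrightarrow> \<bar>det (\<chi> i. homogenize (\<Psi> (z i)))\<bar> \<le> C x * t ^ N"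
    by metis
  obtain F where F: "F \<subseteq> V" "finite F" "V \<subseteq> (\<Union>x\<in>F. ball x (r x))"
    by (rule compactE_image[OF \<open>compact V\<close>, of V "\<lambda>x. ball x (r x)"]) (use r in \<open>auto\<close>)
  have "\<exists>\<delta>>0. \<forall>T\<subseteq>V. T \<noteq> {} \<longrightarrow> diameter T < \<delta> \<longrightarrow> (\<exists>x\<in>F. T \<subseteq> ball x (r x))"
  proof (cases "V = {}")
    case False
    then have "(\<lambda>x. ball x (r x)) ` F \<noteq> {}" using F by auto
    then obtain \<delta> where "0 < \<delta>"
      "\<And>T. \<lbrakk>T \<subseteq> V; diameter T < \<delta>\<rbrakk> \<Longrightarrow> \<exists>B\<in>(\<lambda>x. ball x (r x)) ` F. T \<subseteq> B"
      by (rule Lebesgue_number_lemma[OF \<open>compact V\<close>]) (use F in auto)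
    then show ?thesis by (intro exI[of _ \<delta>]) auto
  qed (auto intro: exI[of _ 1])
  then obtain \<delta> where \<delta>: "0 < \<delta>"
    "\<And>T. T \<subseteq> V \<Longrightarrow> T \<noteq> {} \<Longrightarrow> diameter T < \<delta> \<Longrightarrow> \<exists>x\<in>F. T \<subseteq> ball x (r x)"
    by blast
  show thesis
  proof (rule that[of "min \<delta> 1" "\<Sum>x\<in>F. C x"])
    show "0 < min \<delta> 1" using \<delta>(1) by simp
    show "0 \<le> (\<Sum>x\<in>F. C x)" using F(1) C0 by (auto intro: sum_nonneg)
    fix z :: "'d option \<Rightarrow> real^'k" and t
    assume t: "0 \<le> t" "t < min \<delta> 1" and z: "range z \<subseteq> V" and dist: "\<And>i j. norm (z i - z j) \<le> t"
    have "diameter (range z) \<le> t"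
      using t(1) dist by (intro diameter_le) auto
    then obtain x where x: "x \<in> F" "range z \<subseteq> ball x (r x)"
      using \<delta>(2)[OF z] t(2) by auto
    then have "\<bar>det (\<chi> i. homogenize (\<Psi> (z i)))\<bar> \<le> C x * t ^ N"
      using F(1) t dist by (intro C) auto
    also have "\<dots> \<le> (\<Sum>x\<in>F. C x) * t ^ N"
      using x(1) F C0 t(1) by (intro mult_right_mono member_le_sum) auto
    finally show "\<bar>det (\<chi> i. homogenize (\<Psi> (z i)))\<bar> \<le> (\<Sum>x\<in>F. C x) * t ^ N" .
  qed
qed

section \<open>Rational points in a hyperplane\<close>

text \<open>
  Clearing the denominator of each row gives an integer matrix, since the extra coordinate \<open>1\<close>
  becomes \<open>q i\<close>. So each denominator
  enters only once, although it divides a whole row.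
\<close>

lemma rational_det_lower_bound:
  fixes p :: "'d option \<Rightarrow> int^'d" and q :: "'d option \<Rightarrow> nat"
  assumes q: "\<And>i. q i \<ge> 1"
    and nz: "det (\<chi> i. homogenize (rational_point (p i) (q i))) \<noteq> 0"
  shows "1 \<le> (\<Prod>i\<in>UNIV. real (q i)) * \<bar>det (\<chi> i. homogenize (rational_point (p i) (q i)))\<bar>"
proof -
  let ?A = "\<chi> i. homogenize (rational_point (p i) (q i)) :: real^'d option^'d option"
  define Z :: "'d option \<Rightarrow> 'd option \<Rightarrow> int"
    where "Z i j = (case j of None \<Rightarrow> int (q i) | Some j \<Rightarrow> p i $ j)" for i j
  have "real (q i) *s homogenize (rational_point (p i) (q i)) = (\<chi> j. of_int (Z i j))" for i
    using q[of i] by (auto simp: vec_eq_iff homogenize_def rational_point_def Z_def split: option.splits)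
  then have "(\<Prod>i\<in>UNIV. real (q i)) * det ?A = det (\<chi> i j. real_of_int (Z i j))"
    using det_rows_mul[of "\<lambda>i. real (q i)" "\<lambda>i. homogenize (rational_point (p i) (q i))"] by simp
  also have "\<dots> = of_int (\<Sum>\<pi> | \<pi> permutes UNIV. sign \<pi> * (\<Prod>i\<in>UNIV. Z i (\<pi> i)))"
    by (simp add: det_def)
  finally obtain m :: int where m: "(\<Prod>i\<in>UNIV. real (q i)) * det ?A = of_int m" by blast
  have "(\<Prod>i\<in>UNIV. real (q i)) \<noteq> 0"
    using q by (simp add: prod_zero_iff Suc_le_eq)
  then have "m \<noteq> 0" using m nz by (metis mult_eq_0_iff of_int_0)
  then have "1 \<le> \<bar>real_of_int m\<bar>" by linarith
  then have "1 \<le> \<bar>(\<Prod>i\<in>UNIV. real (q i)) * det ?A\<bar>"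
    by (simp only: m)
  also have "\<dots> = (\<Prod>i\<in>UNIV. real (q i)) * \<bar>det ?A\<bar>"
    by (simp only: abs_mult abs_prod abs_of_nat)
  finally show ?thesis .
qed

text \<open>
  If the homogenizations spanned the whole space, then \<open>d + 1\<close> of them would form a basis and have a
  nonzero determinant. So they lie in a linear hyperplane \<open>a \<bullet> y = 0\<close>, which meets the points with
  extra coordinate \<open>1\<close> in an affine hyperplane, except when only the \<open>None\<close> component of \<open>a\<close> is nonzero, which forces \<open>S\<close> to be empty.
\<close>

lemma subset_affine_hyperplane_if_dets_vanish:
  fixes S :: "(real^'d) set"
  assumes vanish: "\<And>P :: 'd option \<Rightarrow> real^'d. range P \<subseteq> S \<Longrightarrow> det (\<chi> i. homogenize (P i)) = 0"
  shows "\<exists>H. affine_hyperplane H \<and> S \<subseteq> H"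
proof -
  have "dim (homogenize ` S) < DIM(real^'d option)"
  proof (rule ccontr)
    assume "\<not> dim (homogenize ` S) < DIM(real^'d option)"
    then have full: "CARD('d option) \<le> dim (homogenize ` S)" by simp
    obtain B where B: "B \<subseteq> homogenize ` S" "independent B" "card B = dim (homogenize ` S)"
      by (rule basis_exists[of "homogenize ` S"])
    have finB: "finite B" using B(2) independent_bound by blast
    have "card B \<le> CARD('d option)"
      using independent_bound[OF B(2)] by simp
    then have card_B: "card (UNIV :: 'd option set) = card B"
      using full B(3) by linarith
    obtain b :: "'d option \<Rightarrow> real^'d option" where "bij_betw b UNIV B"
      using finite_same_card_bij[OF finite finB card_B] by blast
    then have b: "range b = B"
      by (simp add: bij_betw_def)
    then have "\<exists>x\<in>S. b i = homogenize x" for i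
      using B(1) by blast
    then obtain P where P: "\<And>i. P i \<in> S" "\<And>i. b i = homogenize (P i)"
      by metis
    have "rows (\<chi> i. b i) = B"
      using b by (simp add: rows_def row_def full_SetCompr_eq)
    then have "rank (\<chi> i. b i) = CARD('d option)"
      by (simp only: row_rank_def dim_eq_card_independent[OF B(2)] card_B)
    then have "det (\<chi> i. b i) \<noteq> 0"
      by (simp only: det_eq_0_rank less_irrefl not_False_eq_True)
    moreover have "det (\<chi> i. b i) = 0"
      using vanish[of P] P(1) unfolding P(2) by blast
    ultimately show False by simp
  qed
  then obtain a :: "real^'d option" where a: "a \<noteq> 0" "span (homogenize ` S) \<subseteq> {x. a \<bullet> x = 0}"
    using lowdim_subset_hyperplane by blast
  define a' :: "real^'d" where "a' = (\<chi> j. a $ Some j)"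
  have inner: "a \<bullet> homogenize x = a $ None + a' \<bullet> x" for x
    by (simp add: inner_vec_def homogenize_def a'_def UNIV_option_conv sum.reindex)
  have on: "a' \<bullet> x = - a $ None" if "x \<in> S" for x
  proof -
    have "a \<bullet> homogenize x = 0"
      using a(2) that span_base by blast
    then show ?thesis by (simp add: inner)
  qed
  show ?thesis
  proof (cases "a' = 0")
    case True
    then have "a $ Some j = 0" for j
      by (simp add: a'_def vec_eq_iff)
    then have "a $ None \<noteq> 0"
      using a(1) by (auto simp: vec_eq_iff split: option.split_asm) (metis not_None_eq)
    then have "S = {}" using on True by auto
    moreover have "affine_hyperplane {x. (1 :: real^'d) \<bullet> x = 0}"
      unfolding affine_hyperplane_def by (metis zero_neq_one)
    ultimately show ?thesis by blast
  next
    case False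
    then show ?thesis
      using on by (intro exI[of _ "{x. a' \<bullet> x = - a $ None}"]) (auto simp: affine_hyperplane_def)
  qed
qed

theorem lemma4p1:
  fixes M :: "(real^'d) set"
    and U V :: "(real^'k) set"
    and \<Psi> :: "real^'k \<Rightarrow> real^'d"
  assumes "CARD('k) \<le> CARD('d)"
    and "smooth_submanifold CARD('k) M"
    and "local_parameterization M U \<Psi>"
    and "compact V" and "V \<subseteq> U"
  shows "\<exists>\<kappa>>0. \<forall>s\<in>U. \<forall>\<rho>. 0 < \<rho> \<and> \<rho> \<le> 1 \<longrightarrow>
           (\<exists>H. affine_hyperplane H \<and> small_rational_points \<Psi> V \<kappa> s \<rho> \<subseteq> H)"
proof -
  define n where "n = Suc (n_const CARD('k) CARD('d))"
  define N where "N = N_const CARD('k) CARD('d)"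
  define e where "e = real N / (real CARD('d) + 1)"
  have "1 \<le> CARD('k)"
    using zero_less_card_finite[where 'a='k] by linarith
  then have "CARD('d option) * n = N + (\<Sum>j<n. (n - j) * bracket (CARD('k) - 1) j)"
    unfolding n_def N_def using N_const_identity[OF _ assms(1)] by simp
  then have weight: "CARD('d option) * n = N + (\<Sum>\<alpha> | size (\<alpha>::'k multiset) < n. n - size \<alpha>)"
    by (simp add: sum_multisets_size_less[of "\<lambda>j. n - j"])
  have "open U" "smooth_map_on U \<Psi>"
    using assms(3) by (auto simp: local_parameterization_def diffeomorphism_onto_def)
  then obtain \<delta> C where \<delta>: "0 < \<delta>" and C: "0 \<le> C"
    and bound: "\<And>(z :: 'd option \<Rightarrow> real^'k) t. \<lbrakk>0 \<le> t; t < \<delta>; range z \<subseteq> V; \<And>i j. norm (z i - z j) \<le> t\<rbrakk> \<Longrightarrow>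
        \<bar>det (\<chi> i. homogenize (\<Psi> (z i)))\<bar> \<le> C * t ^ N"
    using uniform_det_bound[OF _ _ assms(4,5) weight] by blast
  \<comment> \<open>Points of a max norm ball of radius \<open>\<rho>\<close> have Euclidean distance at most \<open>L * \<rho>\<close>.\<close>
  define L where "L = 2 * sqrt CARD('k)"
  have L: "0 < L" by (simp add: L_def)
  define K where "K = C * L ^ N"
  have K: "0 \<le> K" using C L by (simp add: K_def)
  \<comment> \<open>The first bound makes the determinants of the points less than the reciprocal of the product of
    their denominators; the second one leaves no denominator \<open>q \<ge> 1\<close> when \<open>L * \<rho> \<ge> \<delta>\<close>.\<close>
  define \<kappa> where "\<kappa> = min (1 / (K + 2)) ((\<delta> / L) powr e / 2)"
  have \<kappa>0: "0 < \<kappa>"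
    using K \<delta> L by (simp add: \<kappa>_def)
  have \<kappa>1: "\<kappa> \<le> 1" and \<kappa>K: "\<kappa> * K < 1"
  proof -
    have \<kappa>: "\<kappa> \<le> 1 / (K + 2)" by (simp add: \<kappa>_def)
    also have "\<dots> \<le> 1" using K by simp
    finally show "\<kappa> \<le> 1" .
    have "\<kappa> * K \<le> 1 / (K + 2) * K"
      using \<kappa> K by (rule mult_right_mono)
    also have "\<dots> < 1" using K by simp
    finally show "\<kappa> * K < 1" .
  qed
  have exponent: "- 1 / c_const CARD('k) CARD('d) = - e"
    by (simp add: c_const_def e_def N_def)
  have "\<exists>H. affine_hyperplane H \<and> small_rational_points \<Psi> V \<kappa> s \<rho> \<subseteq> H"
    if \<rho>: "0 < \<rho>" "\<rho> \<le> 1" for s \<rho>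
  proof (rule subset_affine_hyperplane_if_dets_vanish, rule ccontr)
    fix P :: "'d option \<Rightarrow> real^'d"
    assume P: "range P \<subseteq> small_rational_points \<Psi> V \<kappa> s \<rho>"
      and nz: "det (\<chi> i. homogenize (P i)) \<noteq> 0"
    have "\<forall>i. \<exists>p q z. P i = rational_point p q \<and> 1 \<le> q \<and> real q \<le> \<kappa> * \<rho> powr (- e) \<and>
        z \<in> V \<and> infnorm (z - s) \<le> \<rho> \<and> P i = \<Psi> z"
    proof
      fix i
      have "P i \<in> small_rational_points \<Psi> V \<kappa> s \<rho>" using P by auto
      then obtain p q where "P i = rational_point p q" "1 \<le> q" "real q \<le> \<kappa> * \<rho> powr (- e)"
        "P i \<in> \<Psi> ` (V \<inter> max_norm_cball s \<rho>)"
        unfolding small_rational_points_def exponent reduced_def by auto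
      then show "\<exists>p q z. P i = rational_point p q \<and> 1 \<le> q \<and> real q \<le> \<kappa> * \<rho> powr (- e) \<and>
          z \<in> V \<and> infnorm (z - s) \<le> \<rho> \<and> P i = \<Psi> z"
        unfolding max_norm_cball_def by blast
    qed
    then obtain p q z where Pq: "\<And>i. P i = rational_point (p i) (q i)"
      and q1: "\<And>i. 1 \<le> q i" and q: "\<And>i. real (q i) \<le> \<kappa> * \<rho> powr (- e)"
      and zV: "\<And>i. z i \<in> V" and zs: "\<And>i. infnorm (z i - s) \<le> \<rho>" and Pz: "\<And>i. P i = \<Psi> (z i)"
      by metis
    have small: "L * \<rho> < \<delta>"
    proof (rule ccontr)
      assume "\<not> L * \<rho> < \<delta>"
      then have "\<delta> / L \<le> \<rho>" using L by (simp add: divide_le_eq mult.commute)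
      then have le: "(\<delta> / L) powr e \<le> \<rho> powr e"
        using \<delta> L by (intro powr_mono2) (auto simp: e_def)
      have "\<kappa> * \<rho> powr (- e) \<le> (\<delta> / L) powr e / 2 * \<rho> powr (- e)"
        by (intro mult_right_mono) (simp_all add: \<kappa>_def)
      with q[of None] have "real (q None) \<le> (\<delta> / L) powr e / 2 * \<rho> powr (- e)"
        by (rule order_trans)
      also have "\<dots> \<le> \<rho> powr e / 2 * \<rho> powr (- e)"
        using le by (intro mult_right_mono) auto
      also have "\<dots> = 1 / 2"
        using \<rho>(1) by (simp add: powr_minus)
      finally show False using q1[of None] by simp
    qed
    have dist: "norm (z i - z j) \<le> L * \<rho>" for i j
    proof -
      have "infnorm (z i - z j) \<le> infnorm (z i - s) + infnorm (z j - s)"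
        using infnorm_triangle[of "z i - s" "s - z j"] infnorm_sub[of s "z j"] by simp
      then have "infnorm (z i - z j) \<le> 2 * \<rho>" using zs[of i] zs[of j] by linarith
      then have le: "sqrt CARD('k) * infnorm (z i - z j) \<le> sqrt CARD('k) * (2 * \<rho>)"
        by (intro mult_left_mono) auto
      have "norm (z i - z j) \<le> sqrt CARD('k) * infnorm (z i - z j)"
        using norm_le_infnorm[of "z i - z j"] by simp
      also note le
      finally show ?thesis by (simp add: L_def)
    qed
    have "\<bar>det (\<chi> i. homogenize (P i))\<bar> \<le> C * (L * \<rho>) ^ N"
      unfolding Pz using L \<rho>(1) small zV dist by (intro bound) auto
    then have upper: "\<bar>det (\<chi> i. homogenize (P i))\<bar> \<le> K * \<rho> ^ N"
      by (simp add: K_def power_mult_distrib mult_ac)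
    have "(\<Prod>i\<in>UNIV. real (q i)) \<le> (\<Prod>i\<in>(UNIV :: 'd option set). \<kappa> * \<rho> powr (- e))"
      using q by (intro prod_mono) auto
    also have "\<dots> = \<kappa> ^ CARD('d option) * (\<rho> powr (- e)) ^ CARD('d option)"
      by (simp add: power_mult_distrib)
    also have "(\<rho> powr (- e)) ^ CARD('d option) = \<rho> powr (- real N)"
    proof -
      have "real CARD('d option) * e = real N"
        by (simp add: e_def add.commute add_nonneg_eq_0_iff)
      then show ?thesis
        using \<rho>(1) by (simp only: powr_power minus_mult_right[symmetric])
    qed
    also have "\<dots> = 1 / \<rho> ^ N"
      using \<rho>(1) by (simp add: powr_minus_divide powr_realpow)
    finally have "(\<Prod>i\<in>UNIV. real (q i)) * \<bar>det (\<chi> i. homogenize (P i))\<bar>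
        \<le> (\<kappa> ^ CARD('d option) * (1 / \<rho> ^ N)) * (K * \<rho> ^ N)"
      using upper \<kappa>0 \<rho>(1) by (intro mult_mono) auto
    also have "\<dots> = \<kappa> ^ CARD('d) * (\<kappa> * K)"
      using \<rho>(1) by simp
    also have "\<dots> \<le> 1 * (\<kappa> * K)"
      using \<kappa>0 \<kappa>1 K by (intro mult_right_mono power_le_one) auto
    also have "\<dots> < 1" using \<kappa>K by simp
    finally show False
      using rational_det_lower_bound[where q = q and p = p, OF q1] nz by (simp add: Pq)
  qed
  then show ?thesis using \<kappa>0 by blast
qed

end
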